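(* Let $D\subset\mathbb{R}^2$ be open and let $f,\nu:D\to\mathbb{R}^4\setminus\{0\}$ be smooth with $\langle f,\nu\rangle=0$, related by the elliptic projective Lelieuvre map, i.e. $f\wedge f_x=-\star(\nu\wedge\nu_y)$ and $f\wedge f_y=\star(\nu\wedge\nu_x)$ on $D$. Assume that $\det|\nu,\nu_x,\nu_y,\nu_{xx}|$ and $\det|\nu,\nu_x,\nu_y,\nu_{yy}|$ vanish nowhere on $D$. Then $$f=\frac{[\nu,\nu_x,\nu_y]}{\sqrt{\det|\nu,\nu_x,\nu_y,\nu_{xx}|}}=\frac{[\nu,\nu_x,\nu_y]}{\sqrt{\det|\nu,\nu_x,\nu_y,\nu_{yy}|}},$$ where each square root denotes a suitably chosen one of the two square roots; that is, there are functions $s,t:D\to\mathbb{R}$ with $s^2=\det|\nu,\nu_x,\nu_y,\nu_{xx}|$, $t^2=\det|\nu,\nu_x,\nu_y,\nu_{yy}|$ and $f=s^{-1}[\nu,\nu_x,\nu_y]=t^{-1}[\nu,\nu_x,\nu_y]$.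
   Context: $f=(f_1,\dots,f_4)$ and $\nu=(\nu_1,\dots,\nu_4)$ are homogeneous coordinate vectors of surfaces in $P^3$ and in the dual space $P_3$, depending on real variables $(x,y)$; subscripts $x,y$ denote partial derivatives; $\langle f,\nu\rangle=\sum_i f_i\nu_i$. $\varepsilon$ is the totally alternating symbol with $\varepsilon_{1234}=1$. For $a,b\in\mathbb{R}^4$, $(a\wedge b)_{ik}=a_ib_k-a_kb_i$; for a skew-symmetric $T$, $(\star T)_{ik}=\frac12\sum_{l,m}\varepsilon_{lmik}T_{lm}$. Thus the equations of the map read $f_if_{k,x}-f_kf_{i,x}=-\sum_{l,m}\varepsilon_{iklm}\nu_l\nu_{m,y}$ and $f_if_{k,y}-f_kf_{i,y}=\sum_{l,m}\varepsilon_{iklm}\nu_l\nu_{m,x}$ for $i,k=1,\dots,4$. For $a,b,c\in\mathbb{R}^4$, $[a,b,c]_i=\sum_{j,k,l}\varepsilon_{ijkl}a_jb_kc_l$. $\det|a_1,a_2,a_3,a_4|$ is the determinant of the matrix formed by the four vectors. *)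

theory Defs
  imports "HOL-Analysis.Analysis"
begin

definition pdx :: "(real \<times> real \<Rightarrow> 'a::real_normed_vector) \<Rightarrow> real \<times> real \<Rightarrow> 'a" where
  "pdx f p = vector_derivative (\<lambda>x. f (x, snd p)) (at (fst p))"

definition pdy :: "(real \<times> real \<Rightarrow> 'a::real_normed_vector) \<Rightarrow> real \<times> real \<Rightarrow> 'a" where
  "pdy f p = vector_derivative (\<lambda>y. f (fst p, y)) (at (snd p))"

text \<open>Only meant for open \<open>D\<close>: there the Frechet differentiability required below makes
  the partial derivatives exist, so that \<^const>\<open>pdx\<close> and \<^const>\<open>pdy\<close> have their intended values.\<close>

primrec Ck_on :: "nat \<Rightarrow> (real \<times> real \<Rightarrow> 'a::real_normed_vector) \<Rightarrow> (real \<times> real) set \<Rightarrow> bool" where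
  "Ck_on 0 f D \<longleftrightarrow> continuous_on D f"
| "Ck_on (Suc k) f D \<longleftrightarrow> f differentiable_on D \<and> Ck_on k (pdx f) D \<and> Ck_on k (pdy f) D"

definition smooth_on :: "(real \<times> real \<Rightarrow> 'a::real_normed_vector) \<Rightarrow> (real \<times> real) set \<Rightarrow> bool" where
  "smooth_on f D \<longleftrightarrow> (\<forall>k. Ck_on k f D)"

text \<open>The indices 1, 2, 3, 4 are the elements of the type \<^typ>\<open>4\<close>, in which \<open>4 = 0\<close>. Thus the
  order of the type is not the order 1, 2, 3, 4 that fixes the sign of \<open>eps\<close>, which is the sign of
  the map taking 1, 2, 3, 4 to \<open>i\<close>, \<open>j\<close>, \<open>k\<close>, \<open>l\<close>.\<close>

definition eps :: "4 \<Rightarrow> 4 \<Rightarrow> 4 \<Rightarrow> 4 \<Rightarrow> real" where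
  "eps i j k l =
    (if distinct [i, j, k, l]
     then of_int (sign (\<lambda>n::4. if n = 1 then i else if n = 2 then j else if n = 3 then k else l))
     else 0)"

definition wedge :: "real^4 \<Rightarrow> real^4 \<Rightarrow> real^4^4" where
  "wedge a b = (\<chi> i k. a $ i * b $ k - a $ k * b $ i)"

definition hodge :: "real^4^4 \<Rightarrow> real^4^4" where
  "hodge T = (\<chi> i k. (1/2) * (\<Sum>l\<in>UNIV. \<Sum>m\<in>UNIV. eps l m i k * T $ l $ m))"

definition triple :: "real^4 \<Rightarrow> real^4 \<Rightarrow> real^4 \<Rightarrow> real^4" where
  "triple a b c =
    (\<chi> i. \<Sum>j\<in>UNIV. \<Sum>k\<in>UNIV. \<Sum>l\<in>UNIV. eps i j k l * a $ j * b $ k * c $ l)"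

definition det4 :: "real^4 \<Rightarrow> real^4 \<Rightarrow> real^4 \<Rightarrow> real^4 \<Rightarrow> real" where
  "det4 a b c d = det (vector [a, b, c, d] :: real^4^4)"

definition elliptic_Lelieuvre_on ::
    "(real \<times> real \<Rightarrow> real^4) \<Rightarrow> (real \<times> real \<Rightarrow> real^4) \<Rightarrow> (real \<times> real) set \<Rightarrow> bool" where
  "elliptic_Lelieuvre_on f \<nu> D \<longleftrightarrow>
    (\<forall>p\<in>D. wedge (f p) (pdx f p) = - hodge (wedge (\<nu> p) (pdy \<nu> p)) \<and>
           wedge (f p) (pdy f p) = hodge (wedge (\<nu> p) (pdx \<nu> p)))"

end

(* Contracting f \<and> f_y = *(\<nu> \<and> \<nu>_x) with \<nu>_x kills the right-hand side, while contracting it with \<nu>_y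
   gives N = [\<nu>, \<nu>_x, \<nu>_y], which is nonzero. The first makes f orthogonal to \<nu>_x (otherwise f_y
   would be a multiple of f and N = 0); symmetrically f is orthogonal to \<nu>_y. The contraction
   with \<nu>_y then reads t f = N with t = <f_y, \<nu>_y>, and symmetrically s f = N with
   s = <f_x, \<nu>_x>. Differentiating <f, \<nu>_x> = 0 gives s = - <f, \<nu>_xx>, so that
   s^2 = - <N, \<nu>_xx> = det(\<nu>, \<nu>_x, \<nu>_y, \<nu>_xx). *)

theory Submission
  imports Defs
begin

section \<open>The Levi-Civita symbol as the sign of a permutation\<close>

definition index_map :: "4 \<Rightarrow> 4 \<Rightarrow> 4 \<Rightarrow> 4 \<Rightarrow> 4 \<Rightarrow> 4" where
  "index_map i j k l = (\<lambda>n. if n = 1 then i else if n = 2 then j else if n = 3 then k else l)"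

lemma index_map_simps [simp]:
  "index_map i j k l 1 = i" "index_map i j k l 2 = j"
  "index_map i j k l 3 = k" "index_map i j k l 4 = l"
  by (simp_all add: index_map_def)

lemma eps_eq: "eps i j k l = (if distinct [i, j, k, l] then of_int (sign (index_map i j k l)) else 0)"
  by (simp add: eps_def index_map_def)

lemma eps_nonzero_iff: "eps i j k l \<noteq> 0 \<longleftrightarrow> distinct [i, j, k, l]"
  by (simp add: eps_eq sign_def)

lemma index_map_permutes:
  assumes "distinct [i, j, k, l]"
  shows "index_map i j k l permutes UNIV"
proof -
  have "inj (index_map i j k l)"
  proof (rule injI)
    fix m n assume "index_map i j k l m = index_map i j k l n"
    then show "m = n"
      using assms exhaust_4[of m] exhaust_4[of n] by auto
  qed
  then show ?thesis
    by (intro bij_imp_permutes) (auto simp: bij_def finite_UNIV_inj_surj)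
qed

text \<open>With \<open>index_map_permutes\<close>, this matches permutations of the four indices
  with quadruples of distinct indices, which is what reindexes the Leibniz formula.\<close>

lemma index_map_collapse: "index_map (q 1) (q 2) (q 3) (q 4) = q"
proof
  fix n show "index_map (q 1) (q 2) (q 3) (q 4) n = q n"
    using exhaust_4[of n] by auto
qed

lemma sign_index_map_transpose:
  assumes "distinct [i, j, k, l]" "a \<noteq> b"
  shows "sign (index_map i j k l \<circ> Transposition.transpose a b) = - sign (index_map i j k l)"
proof -
  have "permutation (index_map i j k l)"
    using index_map_permutes[OF assms(1)] permutation_permutes finite by blast
  then show ?thesis
    using assms(2) by (simp add: sign_compose permutation_swap_id sign_swap_id)
qed

text \<open>Swapping two arguments precomposes the index map with a transposition of positions,
  which flips its sign; with repeated indices both sides are 0.\<close>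

lemma eps_swap12: "eps j i k l = - eps i j k l"
proof -
  have "index_map j i k l = index_map i j k l \<circ> Transposition.transpose 1 2"
    by (rule ext) (auto simp: index_map_def Transposition.transpose_def)
  then show ?thesis
    using sign_index_map_transpose[of i j k l 1 2] by (auto simp: eps_eq)
qed

lemma eps_swap23: "eps i k j l = - eps i j k l"
proof -
  have "index_map i k j l = index_map i j k l \<circ> Transposition.transpose 2 3"
    by (rule ext) (auto simp: index_map_def Transposition.transpose_def)
  then show ?thesis
    using sign_index_map_transpose[of i j k l 2 3] by (auto simp: eps_eq)
qed

lemma eps_swap34: "eps i j l k = - eps i j k l"
proof -
  \<comment> \<open>Position 4 is only the final else branch of \<open>index_map\<close>, so n has
    to be split into its four values to recognise it.\<close>
  have "index_map i j l k n = (index_map i j k l \<circ> Transposition.transpose 3 4) n" for n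
    using exhaust_4[of n] by (auto simp: Transposition.transpose_def)
  then have "index_map i j l k = index_map i j k l \<circ> Transposition.transpose 3 4"
    by blast
  then show ?thesis
    using sign_index_map_transpose[of i j k l 3 4] by (auto simp: eps_eq)
qed

text \<open>Moving one pair past the other takes four adjacent swaps, an even permutation. This
  reconciles the index order in \<open>hodge\<close> with that in \<open>triple\<close>.\<close>

lemma eps_rotate: "eps l m i k = eps i k l m"
  using eps_swap23[of l m i k] eps_swap12[of l i m k] eps_swap34[of i l m k] eps_swap23[of i l k m]
  by simp

section \<open>Triple products and determinants\<close>

lemma triple_swap12: "triple b a c = - triple a b c"
proof -
  have "triple b a c $ i = - triple a b c $ i" for i
  proof -
    \<comment> \<open>The free index holds the first slot of \<open>eps\<close>, so after renaming
      the summation indices the swap of the first two vectors is \<open>eps_swap23\<close>.\<close>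
    have "triple b a c $ i = (\<Sum>k\<in>UNIV. \<Sum>j\<in>UNIV. \<Sum>l\<in>UNIV. eps i j k l * b $ j * a $ k * c $ l)"
      by (simp add: triple_def) (rule sum.swap)
    also have "\<dots> = - triple a b c $ i"
      by (simp add: triple_def flip: sum_negf) (intro sum.cong refl, subst eps_swap23, simp)
    finally show ?thesis .
  qed
  then show ?thesis by (simp add: vec_eq_iff)
qed

lemma triple_swap23: "triple a c b = - triple a b c"
proof -
  have "triple a c b $ i = - triple a b c $ i" for i
  proof -
    have "triple a c b $ i = (\<Sum>j\<in>UNIV. \<Sum>l\<in>UNIV. \<Sum>k\<in>UNIV. eps i j k l * a $ j * c $ k * b $ l)"
      by (simp add: triple_def) (rule sum.cong[OF refl], rule sum.swap)
    also have "\<dots> = - triple a b c $ i"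
      by (simp add: triple_def flip: sum_negf) (intro sum.cong refl, subst eps_swap34, simp)
    finally show ?thesis .
  qed
  then show ?thesis by (simp add: vec_eq_iff)
qed

lemma triple_same13: "triple a b a = 0"
  using triple_swap12[of a a b] triple_swap23[of a b a] by (simp add: vec_eq_iff)

lemma vector_4:
  "(vector [a, b, c, d] :: 'a::zero^4) $ 1 = a" "(vector [a, b, c, d] :: 'a^4) $ 2 = b"
  "(vector [a, b, c, d] :: 'a^4) $ 3 = c" "(vector [a, b, c, d] :: 'a^4) $ 4 = d"
  by (simp_all add: vector_def)

text \<open>This is the Leibniz formula with each permutation q encoded by its values (q 1, q 2, q
  3, q 4).\<close>

lemma det4_eq_sum:
  "det4 a b c d =
    (\<Sum>i\<in>UNIV. \<Sum>j\<in>UNIV. \<Sum>k\<in>UNIV. \<Sum>l\<in>UNIV. eps i j k l * a $ i * b $ j * c $ k * d $ l)"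
proof -
  let ?Q = "{(i, j, k, l). eps i j k l \<noteq> 0}"
  let ?g = "\<lambda>(i, j, k, l). eps i j k l * a $ i * b $ j * c $ k * d $ l"
  have prod4: "(\<Prod>i\<in>UNIV. h i) = h 1 * h 2 * h 3 * h 4" for h :: "4 \<Rightarrow> real"
    unfolding UNIV_4 by (simp add: mult.assoc)
  have "det4 a b c d = (\<Sum>q | q permutes (UNIV :: 4 set).
      of_int (sign q) * (a $ q 1 * b $ q 2 * c $ q 3 * d $ q 4))"
    unfolding det4_def det_def prod4 vector_4 ..
  also have "\<dots> = sum ?g ?Q"
  proof (rule sum.reindex_bij_witness[where i = "\<lambda>(i, j, k, l). index_map i j k l"
        and j = "\<lambda>q. (q 1, q 2, q 3, q 4)"])
    fix q :: "4 \<Rightarrow> 4" assume "q \<in> {q. q permutes UNIV}"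
    then have "inj q" by (simp add: permutes_inj)
    show "(case (q 1, q 2, q 3, q 4) of (i, j, k, l) \<Rightarrow> index_map i j k l) = q"
      by (simp add: index_map_collapse[of q])
    show "(q 1, q 2, q 3, q 4) \<in> ?Q" using \<open>inj q\<close> by (simp add: eps_nonzero_iff inj_eq)
    show "?g (q 1, q 2, q 3, q 4) = of_int (sign q) * (a $ q 1 * b $ q 2 * c $ q 3 * d $ q 4)"
      using \<open>inj q\<close> by (simp add: eps_eq inj_eq index_map_collapse[of q])
  qed (auto simp: eps_nonzero_iff intro!: index_map_permutes)
  \<comment> \<open>The added quadruples have \<open>eps\<close> equal to 0.\<close>
  also have "\<dots> = sum ?g UNIV"
    by (rule sum.mono_neutral_left) auto
  also have "\<dots> = (\<Sum>i\<in>UNIV. \<Sum>j\<in>UNIV. \<Sum>k\<in>UNIV. \<Sum>l\<in>UNIV.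
      eps i j k l * a $ i * b $ j * c $ k * d $ l)"
    by (simp add: sum.cartesian_product split_def)
  finally show ?thesis .
qed

lemma inner_triple: "d \<bullet> triple a b c = det4 d a b c"
  by (simp add: det4_eq_sum triple_def inner_vec_def sum_distrib_left mult_ac)

text \<open>Moving d from the last slot to the first passes three vectors, an odd permutation: here
  one exchange of a and d, then a cyclic, hence even, shift inside \<open>triple\<close>.\<close>

lemma det4_eq_inner_triple: "det4 a b c d = - (triple a b c \<bullet> d)"
proof -
  have "a \<bullet> triple d b c = - (d \<bullet> triple a b c)"
  proof -
    have "a \<bullet> triple d b c = (\<Sum>j\<in>UNIV. \<Sum>i\<in>UNIV. \<Sum>k\<in>UNIV. \<Sum>l\<in>UNIV.
        eps i j k l * a $ i * d $ j * b $ k * c $ l)"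
      unfolding inner_triple det4_eq_sum by (rule sum.swap)
    also have "\<dots> = - (d \<bullet> triple a b c)"
      unfolding inner_triple det4_eq_sum sum_negf[symmetric]
      by (intro sum.cong refl, subst eps_swap12, simp)
    finally show ?thesis .
  qed
  moreover have "a \<bullet> triple b c d = a \<bullet> triple d b c"
    by (simp add: triple_swap12[of d b c] triple_swap23[of b d c])
  ultimately show ?thesis
    by (simp add: inner_triple[symmetric] inner_commute)
qed

section \<open>Contracting the Lelieuvre equations with a vector\<close>

lemma wedge_mult_vec: "wedge a b *v c = (b \<bullet> c) *\<^sub>R a - (a \<bullet> c) *\<^sub>R b"
  by (simp add: vec_eq_iff wedge_def matrix_vector_mult_def inner_vec_def
      sum_distrib_left sum_distrib_right sum_subtractf algebra_simps)

lemma hodge_wedge_mult_vec: "hodge (wedge a b) *v c = triple c a b"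
proof -
  have 1: "hodge (wedge a b) $ i $ k = (\<Sum>l\<in>UNIV. \<Sum>m\<in>UNIV. eps i k l m * a $ l * b $ m)" for i k
  proof -
    \<comment> \<open>The second half of the wedge contributes as much as the first, which cancels
      the factor 1/2.\<close>
    have "(\<Sum>l\<in>UNIV. \<Sum>m\<in>UNIV. eps i k l m * a $ m * b $ l)
        = (\<Sum>m\<in>UNIV. \<Sum>l\<in>UNIV. eps i k l m * a $ m * b $ l)"
      by (rule sum.swap)
    also have "\<dots> = - (\<Sum>l\<in>UNIV. \<Sum>m\<in>UNIV. eps i k l m * a $ l * b $ m)"
      unfolding sum_negf[symmetric] by (intro sum.cong refl, subst eps_swap34, simp)
    finally show ?thesis
      by (simp add: hodge_def wedge_def eps_rotate[of _ _ i k] right_diff_distrib sum_subtractf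
          mult_ac)
  qed
  show ?thesis
    by (simp add: vec_eq_iff matrix_vector_mult_def 1 triple_def sum_distrib_left sum_distrib_right
        mult_ac)
qed

text \<open>Serves both equations: a is \<nu>, b the derivative of \<nu> in the equation, c the
  other one, and g is \<open>pdy f p\<close> or \<open>- pdx f p\<close>.\<close>

lemma inner_zero_if_wedge_eq_hodge_wedge:
  assumes eq: "wedge f g = hodge (wedge a b)" and nz: "triple c a b \<noteq> 0"
  shows "f \<bullet> b = 0"
proof (rule ccontr)
  assume "f \<bullet> b \<noteq> 0"
  have "(g \<bullet> b) *\<^sub>R f - (f \<bullet> b) *\<^sub>R g = 0"
    using arg_cong[OF eq, of "\<lambda>M. M *v b"]
    by (simp add: wedge_mult_vec hodge_wedge_mult_vec triple_same13)
  then have "g = ((g \<bullet> b) / (f \<bullet> b)) *\<^sub>R f"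
    using \<open>f \<bullet> b \<noteq> 0\<close> by (simp add: vec_eq_iff field_simps)
  then obtain r where "g = r *\<^sub>R f" by blast
  then have "wedge f g *v c = 0"
    by (simp add: wedge_mult_vec)
  then show False
    using nz by (simp add: eq hodge_wedge_mult_vec)
qed

lemma wedge_uminus_right: "wedge a (- b) = - wedge a b"
  by (simp add: wedge_def vec_eq_iff)

section \<open>Differentiating orthogonality relations\<close>

lemma pdx_has_vector_derivative:
  assumes "open D" "f differentiable_on D" "(x, y) \<in> D"
  shows "((\<lambda>u. f (u, y)) has_vector_derivative pdx f (x, y)) (at x)"
proof -
  have "f differentiable (at (x, y))"
    using assms differentiable_on_eq_differentiable_at by blast
  moreover have "(\<lambda>u. (u, y)) differentiable (at x)"
    by (auto simp: differentiable_def intro!: exI derivative_eq_intros)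
  ultimately have "f \<circ> (\<lambda>u. (u, y)) differentiable (at x)"
    by (intro differentiable_chain_at) simp_all
  then show ?thesis
    by (simp add: pdx_def vector_derivative_works o_def)
qed

lemma pdy_has_vector_derivative:
  assumes "open D" "f differentiable_on D" "(x, y) \<in> D"
  shows "((\<lambda>u. f (x, u)) has_vector_derivative pdy f (x, y)) (at y)"
proof -
  have "f differentiable (at (x, y))"
    using assms differentiable_on_eq_differentiable_at by blast
  moreover have "(\<lambda>u. (x, u)) differentiable (at y)"
    by (auto simp: differentiable_def intro!: exI derivative_eq_intros)
  ultimately have "f \<circ> (\<lambda>u. (x, u)) differentiable (at y)"
    by (intro differentiable_chain_at) simp_all
  then show ?thesis
    by (simp add: pdy_def vector_derivative_works o_def)
qed

lemma inner_vector_derivative_zero: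
  assumes "(f has_vector_derivative f') (at x)" "(g has_vector_derivative g') (at x)"
    and "eventually (\<lambda>u. f u \<bullet> g u = (0::real)) (nhds x)"
  shows "f' \<bullet> g x + f x \<bullet> g' = 0"
proof -
  have "((\<lambda>u. f u \<bullet> g u) has_vector_derivative f x \<bullet> g' + f' \<bullet> g x) (at x)"
    using bounded_bilinear.has_vector_derivative[OF bounded_bilinear_inner assms(1,2)] .
  moreover have "((\<lambda>u. f u \<bullet> g u) has_vector_derivative 0) (at x)"
    using assms(3) by (subst has_vector_derivative_cong_ev[where g = "\<lambda>_. 0"])
      (auto elim: eventually_mono dest: eventually_nhds_x_imp_x)
  ultimately show ?thesis
    using vector_derivative_unique_at by fastforce
qed

lemma inner_pdx_zero:
  assumes "open D" "f differentiable_on D" "g differentiable_on D" "p \<in> D"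
    and "\<And>q. q \<in> D \<Longrightarrow> f q \<bullet> g q = 0"
  shows "pdx f p \<bullet> g p + f p \<bullet> pdx g p = 0"
proof -
  obtain x y where p: "p = (x, y)" by fastforce
  \<comment> \<open>As D is open, the horizontal line through p stays in D near p, so the product
    vanishes on a neighbourhood and not just at p.\<close>
  have "eventually (\<lambda>u. (u, y) \<in> D) (nhds x)"
    using topological_tendstoD[OF tendsto_Pair[OF filterlim_ident tendsto_const] assms(1)] assms(4) p by simp
  then have "eventually (\<lambda>u. f (u, y) \<bullet> g (u, y) = 0) (nhds x)"
    by (rule eventually_mono) (rule assms(5))
  then show ?thesis
    using inner_vector_derivative_zero[OF pdx_has_vector_derivative pdx_has_vector_derivative] assms p
    by blast
qed

lemma inner_pdy_zero:
  assumes "open D" "f differentiable_on D" "g differentiable_on D" "p \<in> D"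
    and "\<And>q. q \<in> D \<Longrightarrow> f q \<bullet> g q = 0"
  shows "pdy f p \<bullet> g p + f p \<bullet> pdy g p = 0"
proof -
  obtain x y where p: "p = (x, y)" by fastforce
  have "eventually (\<lambda>u. (x, u) \<in> D) (nhds y)"
    using topological_tendstoD[OF tendsto_Pair[OF tendsto_const filterlim_ident] assms(1)] assms(4) p by simp
  then have "eventually (\<lambda>u. f (x, u) \<bullet> g (x, u) = 0) (nhds y)"
    by (rule eventually_mono) (rule assms(5))
  then show ?thesis
    using inner_vector_derivative_zero[OF pdy_has_vector_derivative pdy_has_vector_derivative] assms p
    by blast
qed

lemma smooth_on_differentiable:
  assumes "smooth_on f D"
  shows "f differentiable_on D" "pdx f differentiable_on D" "pdy f differentiable_on D"
proof -
  have "Ck_on (Suc (Suc 0)) f D"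
    using assms unfolding smooth_on_def by blast
  then show "f differentiable_on D" "pdx f differentiable_on D" "pdy f differentiable_on D"
    by auto
qed

text \<open>The algebra common to both square roots, with d the second derivative of \<nu> in x or
  in y. The nonzero determinant forces s to be nonzero, so s can be inverted.\<close>

lemma square_eq_det4_if_scaleR_eq_triple:
  assumes "s *\<^sub>R f = triple a b c" "s + f \<bullet> d = 0" "det4 a b c d \<noteq> 0"
  shows "s\<^sup>2 = det4 a b c d" "f = inverse s *\<^sub>R triple a b c"
proof -
  have "triple a b c \<bullet> d = s * (f \<bullet> d)"
    by (simp add: assms(1)[symmetric])
  moreover have "f \<bullet> d = - s"
    using assms(2) by simp
  ultimately show sq: "s\<^sup>2 = det4 a b c d"
    by (simp add: det4_eq_inner_triple power2_eq_square)
  then have "s \<noteq> 0"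
    using assms(3) by auto
  then show "f = inverse s *\<^sub>R triple a b c"
    by (simp add: assms(1)[symmetric])
qed

theorem theorem3p1:
  fixes D :: "(real \<times> real) set"
    and f \<nu> :: "real \<times> real \<Rightarrow> real^4"
  assumes "open D"
    and "smooth_on f D" and "smooth_on \<nu> D"
    and "\<And>p. p \<in> D \<Longrightarrow> f p \<noteq> 0" and "\<And>p. p \<in> D \<Longrightarrow> \<nu> p \<noteq> 0"
    and "\<And>p. p \<in> D \<Longrightarrow> f p \<bullet> \<nu> p = 0"
    and "elliptic_Lelieuvre_on f \<nu> D"
    and "\<And>p. p \<in> D \<Longrightarrow> det4 (\<nu> p) (pdx \<nu> p) (pdy \<nu> p) (pdx (pdx \<nu>) p) \<noteq> 0"
    and "\<And>p. p \<in> D \<Longrightarrow> det4 (\<nu> p) (pdx \<nu> p) (pdy \<nu> p) (pdy (pdy \<nu>) p) \<noteq> 0"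
  shows "\<exists>s t :: real \<times> real \<Rightarrow> real. \<forall>p\<in>D.
    (s p)\<^sup>2 = det4 (\<nu> p) (pdx \<nu> p) (pdy \<nu> p) (pdx (pdx \<nu>) p) \<and>
    (t p)\<^sup>2 = det4 (\<nu> p) (pdx \<nu> p) (pdy \<nu> p) (pdy (pdy \<nu>) p) \<and>
    f p = inverse (s p) *\<^sub>R triple (\<nu> p) (pdx \<nu> p) (pdy \<nu> p) \<and>
    f p = inverse (t p) *\<^sub>R triple (\<nu> p) (pdx \<nu> p) (pdy \<nu> p)"
proof -
  let ?N = "\<lambda>p. triple (\<nu> p) (pdx \<nu> p) (pdy \<nu> p)"
  have Lx: "wedge (f p) (- pdx f p) = hodge (wedge (\<nu> p) (pdy \<nu> p))"
    and Ly: "wedge (f p) (pdy f p) = hodge (wedge (\<nu> p) (pdx \<nu> p))" if "p \<in> D" for p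
    using assms(7) that by (auto simp: elliptic_Lelieuvre_on_def wedge_uminus_right)
  have Nx: "triple (pdx \<nu> p) (\<nu> p) (pdy \<nu> p) = - ?N p" for p
    by (rule triple_swap12)
  have Ny: "triple (pdy \<nu> p) (\<nu> p) (pdx \<nu> p) = ?N p" for p
    by (simp add: triple_swap12[of "pdy \<nu> p" "\<nu> p"] triple_swap23[of "\<nu> p" "pdy \<nu> p"])
  have N: "?N p \<noteq> 0" if "p \<in> D" for p
    using assms(8)[OF that] by (auto simp: det4_eq_inner_triple)
  \<comment> \<open>The equation for \<open>pdy f\<close> contains \<open>pdx \<nu>\<close>, so
    orthogonality to the x-derivative comes from \<open>Ly\<close>, and to the y-derivative from
    \<open>Lx\<close>.\<close>
  have fx: "f p \<bullet> pdx \<nu> p = 0" if "p \<in> D" for p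
    using inner_zero_if_wedge_eq_hodge_wedge[OF Ly[OF that], of "pdy \<nu> p"] N[OF that] by (simp add: Ny)
  have fy: "f p \<bullet> pdy \<nu> p = 0" if "p \<in> D" for p
    using inner_zero_if_wedge_eq_hodge_wedge[OF Lx[OF that], of "pdx \<nu> p"] N[OF that] by (simp add: Nx)
  \<comment> \<open>The minus sign of \<open>- pdx f p\<close> in \<open>Lx\<close> cancels the one
    in \<open>Nx\<close>.\<close>
  have s: "(pdx f p \<bullet> pdx \<nu> p) *\<^sub>R f p = ?N p" if "p \<in> D" for p
    using arg_cong[OF Lx[OF that], of "\<lambda>M. M *v pdx \<nu> p"]
    by (simp add: wedge_mult_vec hodge_wedge_mult_vec fx[OF that] Nx)
  have t: "(pdy f p \<bullet> pdy \<nu> p) *\<^sub>R f p = ?N p" if "p \<in> D" for p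
    using arg_cong[OF Ly[OF that], of "\<lambda>M. M *v pdy \<nu> p"]
    by (simp add: wedge_mult_vec hodge_wedge_mult_vec fy[OF that] Ny)
  note smooth = smooth_on_differentiable[OF assms(2)] smooth_on_differentiable[OF assms(3)]
  have sx: "pdx f p \<bullet> pdx \<nu> p + f p \<bullet> pdx (pdx \<nu>) p = 0" if "p \<in> D" for p
    using inner_pdx_zero[OF assms(1)] smooth that fx by blast
  have ty: "pdy f p \<bullet> pdy \<nu> p + f p \<bullet> pdy (pdy \<nu>) p = 0" if "p \<in> D" for p
    using inner_pdy_zero[OF assms(1)] smooth that fy by blast
  show ?thesis
    by (rule exI[of _ "\<lambda>p. pdx f p \<bullet> pdx \<nu> p"], rule exI[of _ "\<lambda>p. pdy f p \<bullet> pdy \<nu> p"])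
       (use square_eq_det4_if_scaleR_eq_triple[OF s sx assms(8)] square_eq_det4_if_scaleR_eq_triple[OF t ty assms(9)] in blast)
qed

end
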